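(* There is a sequence of $K_4$-free graphs $G_n$, with $G_n$ of order $n$, such that \[\lim_{n\to\infty}\frac{q_n(G_n)}{n}=\frac{60-4\sqrt5}{137+7\sqrt5}=0.3344572553\ldots>\frac13.\]
   Context: Graphs are finite and simple; the order of a graph is its number of vertices. The signless Laplacian matrix of a graph $G$ of order $n$ is $Q(G)=D(G)+A(G)$, where $A(G)$ is the adjacency matrix and $D(G)$ is the diagonal matrix of vertex degrees. Its eigenvalues are $q_1(G)\ge q_2(G)\ge\cdots\ge q_n(G)\ge 0$, so $q_n(G)$ is the least one. A graph is $K_4$-free if it contains no clique on $4$ vertices. *)

theory Defs
  imports Complex_Main "Jordan_Normal_Form.Char_Poly"
begin

text \<open>
  A graph of order \<open>n\<close> has vertex set \<open>{..<n}\<close> and is given by its adjacency relation, so that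
  vertices index the rows and columns of the \<open>n \<times> n\<close> matrices below.
\<close>

definition simple_graph :: "nat \<Rightarrow> (nat \<Rightarrow> nat \<Rightarrow> bool) \<Rightarrow> bool" where
  "simple_graph n E \<longleftrightarrow>
     (\<forall>u v. E u v \<longrightarrow> u < n \<and> v < n) \<and> (\<forall>u. \<not> E u u) \<and> (\<forall>u v. E u v \<longrightarrow> E v u)"

definition is_clique :: "nat \<Rightarrow> (nat \<Rightarrow> nat \<Rightarrow> bool) \<Rightarrow> nat set \<Rightarrow> bool" where
  "is_clique n E K \<longleftrightarrow> K \<subseteq> {..<n} \<and> (\<forall>u\<in>K. \<forall>v\<in>K. u \<noteq> v \<longrightarrow> E u v)"

definition K4_free :: "nat \<Rightarrow> (nat \<Rightarrow> nat \<Rightarrow> bool) \<Rightarrow> bool" where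
  "K4_free n E \<longleftrightarrow> \<not> (\<exists>K. is_clique n E K \<and> card K = 4)"

definition degree_of :: "nat \<Rightarrow> (nat \<Rightarrow> nat \<Rightarrow> bool) \<Rightarrow> nat \<Rightarrow> nat" where
  "degree_of n E u = card {v. v < n \<and> E u v}"

definition adjacency_matrix :: "nat \<Rightarrow> (nat \<Rightarrow> nat \<Rightarrow> bool) \<Rightarrow> real mat" where
  "adjacency_matrix n E = mat n n (\<lambda>(i, j). if E i j then 1 else 0)"

definition degree_matrix :: "nat \<Rightarrow> (nat \<Rightarrow> nat \<Rightarrow> bool) \<Rightarrow> real mat" where
  "degree_matrix n E = mat n n (\<lambda>(i, j). if i = j then real (degree_of n E i) else 0)"

definition signless_laplacian :: "nat \<Rightarrow> (nat \<Rightarrow> nat \<Rightarrow> bool) \<Rightarrow> real mat" where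
  "signless_laplacian n E = degree_matrix n E + adjacency_matrix n E"

definition signless_eigenvalues :: "nat \<Rightarrow> (nat \<Rightarrow> nat \<Rightarrow> bool) \<Rightarrow> real list" where
  "signless_eigenvalues n E =
     rev (sorted_list_of_multiset (proots (char_poly (signless_laplacian n E))))"

text \<open>
  \<open>signless_eigenvalue n E k\<close> is \<open>q\<^sub>k\<close>: the \<open>k\<close>-th largest eigenvalue, counted with multiplicity
  and indexed from 1. It is meaningful for \<open>1 \<le> k \<le> n\<close>, see \<open>length_signless_eigenvalues\<close> below.
\<close>

definition signless_eigenvalue :: "nat \<Rightarrow> (nat \<Rightarrow> nat \<Rightarrow> bool) \<Rightarrow> nat \<Rightarrow> real" where
  "signless_eigenvalue n E k = signless_eigenvalues n E ! (k - 1)"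

lemma symmetric_eigenvalue_real:
  fixes A :: "real mat"
  assumes A: "A \<in> carrier_mat n n" and sym: "A\<^sup>T = A"
    and ev: "eigenvalue (map_mat complex_of_real A) a"
  shows "a \<in> \<real>"
proof -
  let ?B = "map_mat complex_of_real A"
  obtain v where v: "v \<in> carrier_vec n" "v \<noteq> 0\<^sub>v n" "?B *\<^sub>v v = a \<cdot>\<^sub>v v"
    using ev A unfolding eigenvalue_def eigenvector_def by auto
  have B: "?B \<in> carrier_mat n n" using A by auto
  have s: "A $$ (i, j) = A $$ (j, i)" if "i < n" "j < n" for i j
    using that A sym by (metis carrier_matD index_transpose_mat(1))
  have Bv: "(\<Sum>j<n. of_real (A $$ (i, j)) * v $ j) = a * v $ i" if "i < n" for i
  proof -
    have "(?B *\<^sub>v v) $ i = (\<Sum>j<n. of_real (A $$ (i, j)) * v $ j)"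
      using that A v(1) by (auto simp: scalar_prod_def atLeast0LessThan intro!: sum.cong)
    thus ?thesis using v that by simp
  qed
  define N where "N = (\<Sum>i<n. v $ i * cnj (v $ i))"
  have N: "N = of_real (\<Sum>i<n. (cmod (v $ i))\<^sup>2)"
    unfolding N_def of_real_sum by (intro sum.cong refl) (rule complex_norm_square[symmetric])
  obtain i where i: "i < n" "v $ i \<noteq> 0" using v(1,2) by (metis eq_vecI carrier_vecD index_zero_vec)
  have "(\<Sum>i<n. (cmod (v $ i))\<^sup>2) > 0"
    by (rule sum_pos2[of _ i]) (use i in auto)
  hence N0: "N \<noteq> 0" unfolding N by (metis of_real_eq_0_iff less_irrefl)
  have "a * N = (\<Sum>i<n. \<Sum>j<n. of_real (A $$ (i, j)) * v $ j * cnj (v $ i))"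
    unfolding N_def sum_distrib_left
    by (intro sum.cong refl) (simp add: Bv[symmetric] sum_distrib_right mult.assoc[symmetric])
  also have "\<dots> = (\<Sum>j<n. \<Sum>i<n. of_real (A $$ (i, j)) * v $ j * cnj (v $ i))"
    by (rule sum.swap)
  also have "\<dots> = (\<Sum>j<n. v $ j * cnj (\<Sum>i<n. of_real (A $$ (j, i)) * v $ i))"
    by (intro sum.cong refl) (auto simp: sum_distrib_left s algebra_simps intro!: sum.cong)
  also have "\<dots> = cnj a * N"
    unfolding N_def sum_distrib_left by (intro sum.cong refl) (simp add: Bv)
  finally have "a = cnj a" using N0 by simp
  thus ?thesis by (metis Reals_cnj_iff)
qed

lemma size_proots_char_poly_symmetric:
  fixes A :: "real mat"
  assumes A: "A \<in> carrier_mat n n" and sym: "A\<^sup>T = A"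
  shows "size (proots (char_poly A)) = n"
proof -
  let ?B = "map_mat complex_of_real A"
  have B: "?B \<in> carrier_mat n n" using A by auto
  obtain as where as: "char_poly ?B = (\<Prod>a\<leftarrow>as. [:- a, 1:])" "length as = n"
    using char_poly_factorized[OF B] by auto
  have re: "a \<in> \<real>" if "a \<in> set as" for a
  proof -
    have "poly (char_poly ?B) a = 0"
      unfolding as(1) poly_prod_list using that by (auto simp: prod_list_zero_iff image_iff)
    thus ?thesis
      using symmetric_eigenvalue_real[OF A sym] eigenvalue_root_char_poly[OF B] by simp
  qed
  define bs where "bs = map Re as"
  have asbs: "as = map complex_of_real bs"
    unfolding bs_def using re by (simp add: list_eq_iff_nth_eq)
  interpret p: map_poly_inj_comm_ring_hom complex_of_real ..
  have "map_poly complex_of_real (char_poly A) = char_poly ?B"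
    by (rule of_real_hom.char_poly_hom[OF A, symmetric])
  also have "\<dots> = map_poly complex_of_real (\<Prod>b\<leftarrow>bs. [:- b, 1:])"
    unfolding as(1) asbs by (simp add: p.hom_prod_list o_def)
  finally have "char_poly A = (\<Prod>b\<leftarrow>bs. [:- b, 1:])"
    by simp
  moreover have "(\<Prod>b\<leftarrow>bs. [:- b, 1:]) \<noteq> 0 \<and> proots (\<Prod>b\<leftarrow>bs. [:- b, 1:]) = mset bs"
  proof (induction bs)
    case (Cons b bs)
    have "proots ([:- b, 1:] * (\<Prod>b\<leftarrow>bs. [:- b, 1:])) = {#b#} + mset bs"
      using Cons by (subst proots_mult) auto
    thus ?case using Cons by (simp del: mult_pCons_left)
  qed simp
  ultimately show ?thesis using as(2) by (simp add: bs_def)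
qed

lemma signless_laplacian_carrier: "signless_laplacian n E \<in> carrier_mat n n"
  by (simp add: signless_laplacian_def degree_matrix_def adjacency_matrix_def)

lemma signless_laplacian_symmetric:
  assumes "simple_graph n E"
  shows "(signless_laplacian n E)\<^sup>T = signless_laplacian n E"
  using assms unfolding simple_graph_def
  by (intro eq_matI)
    (auto simp: signless_laplacian_def degree_matrix_def adjacency_matrix_def)

lemma length_signless_eigenvalues:
  assumes "simple_graph n E"
  shows "length (signless_eigenvalues n E) = n"
  using size_proots_char_poly_symmetric
    [OF signless_laplacian_carrier signless_laplacian_symmetric[OF assms]]
  unfolding signless_eigenvalues_def by (metis length_rev mset_sorted_list_of_multiset size_mset)

lemma set_signless_eigenvalues:
  "set (signless_eigenvalues n E) = {q. eigenvalue (signless_laplacian n E) q}"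
proof -
  have "char_poly (signless_laplacian n E) \<noteq> 0"
    using degree_monic_char_poly[OF signless_laplacian_carrier, of n E] by auto
  thus ?thesis
    unfolding signless_eigenvalues_def
    by (auto simp: eigenvalue_root_char_poly[OF signless_laplacian_carrier])
qed

lemma signless_eigenvalue_least:
  assumes G: "simple_graph n E" and n: "n \<ge> 1"
  shows "signless_eigenvalue n E n = Min {q. eigenvalue (signless_laplacian n E) q}"
proof -
  let ?xs = "sorted_list_of_multiset (proots (char_poly (signless_laplacian n E)))"
  have len: "length ?xs = n"
    using length_signless_eigenvalues[OF G] by (simp add: signless_eigenvalues_def)
  have "signless_eigenvalue n E n = ?xs ! 0"
    using n len by (simp add: signless_eigenvalue_def signless_eigenvalues_def rev_nth)
  also have "\<dots> = Min (set ?xs)"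
  proof (intro Min_eqI[symmetric])
    show "?xs ! 0 \<in> set ?xs" using n len by (intro nth_mem) simp
    show "?xs ! 0 \<le> y" if "y \<in> set ?xs" for y
      using that by (metis in_set_conv_nth sorted_iff_nth_mono sorted_sorted_list_of_multiset zero_le)
  qed simp
  also have "set ?xs = {q. eigenvalue (signless_laplacian n E) q}"
    using set_signless_eigenvalues[of n E] unfolding signless_eigenvalues_def set_rev .
  finally show ?thesis .
qed

end

theory Submission
  imports Defs
begin

text \<open>
  The graphs are blow-ups of the wheel \<open>W\<^sub>5\<close> by independent sets, with rim classes of equal size
  \<open>m\<close> and a hub class of size \<open>h\<close>. They are \<open>K\<^sub>4\<close>-free because the rim is triangle-free. Summing an
  eigenvector over the classes shows that every eigenvalue is \<open>5m\<close>, \<open>h + 2m\<close>, one of the values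
  \<open>h + 2m - \<phi>m\<close> and \<open>h + 2m + (\<phi> - 1)m\<close> coming from the nontrivial spectrum of the pentagon (\<open>\<phi>\<close> the
  golden ratio), or a root of \<open>(q - 5m)(q - h - 4m) = 5mh\<close>, which comes from the vectors constant
  on the rim. The ratio \<open>m/n\<close> is chosen so that \<open>h + 2m - \<phi>m\<close> and the smaller root of the quadratic
  agree asymptotically.
\<close>

section \<open>The blown-up wheel and why it is K_4-free\<close>

text \<open>The rim is the pentagon \<open>0, \<dots>, 4\<close> and the hub is \<open>5\<close>.\<close>

definition wheel_adj :: "nat \<Rightarrow> nat \<Rightarrow> bool" where
  "wheel_adj i j \<longleftrightarrow> (i = 5) \<noteq> (j = 5) \<or>
     i < 5 \<and> j < 5 \<and> (j = (i + 1) mod 5 \<or> i = (j + 1) mod 5)"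

text \<open>The first \<open>5 * m\<close> vertices form five consecutive rim blocks and the hub
  takes the rest. The order is thus exactly \<open>n\<close>, and any rounding of \<open>m\<close>
  is absorbed by the hub.\<close>

definition part :: "nat \<Rightarrow> nat \<Rightarrow> nat" where
  "part m u = (if u < 5 * m then u div m else 5)"

definition wheel_blowup :: "nat \<Rightarrow> nat \<Rightarrow> nat \<Rightarrow> nat \<Rightarrow> bool" where
  "wheel_blowup n m u v \<longleftrightarrow> u < n \<and> v < n \<and> wheel_adj (part m u) (part m v)"

definition part_sum :: "nat \<Rightarrow> nat \<Rightarrow> (nat \<Rightarrow> real) \<Rightarrow> nat \<Rightarrow> real" where
  "part_sum n m f j = (\<Sum>u | u < n \<and> part m u = j. f u)"

lemma part_le: "part m u \<le> 5"
  by (auto simp: part_def less_mult_imp_div_less less_imp_le)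

lemma less_5_cases:
  fixes i :: nat
  assumes "i < 5"
  obtains "i = 0" | "i = 1" | "i = 2" | "i = 3" | "i = 4"
  using assms by linarith

lemma wheel_adj_irrefl: "\<not> wheel_adj i i"
  by (cases "i < 5") (auto simp: wheel_adj_def elim: less_5_cases)

lemma simple_graph_wheel_blowup: "simple_graph n (wheel_blowup n m)"
  unfolding simple_graph_def wheel_blowup_def
  using wheel_adj_irrefl by (auto simp: wheel_adj_def)

lemma rim_triangle_free:
  assumes "wheel_adj i j" "wheel_adj j k" "wheel_adj i k" "i < 5" "j < 5" "k < 5"
  shows False
  using assms(4-6,1-3)
  by (elim less_5_cases) (simp_all add: wheel_adj_def)

text \<open>The hub is not adjacent to itself, so at most one of the four is the hub; the other
  three would form a triangle on the rim.\<close>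

lemma wheel_K4_free:
  assumes "wheel_adj a b" "wheel_adj a c" "wheel_adj a d"
    "wheel_adj b c" "wheel_adj b d" "wheel_adj c d"
    "a \<le> 5" "b \<le> 5" "c \<le> 5" "d \<le> 5"
  shows False
proof -
  have one: "i < 5 \<or> j < 5" if "wheel_adj i j" "i \<le> 5" "j \<le> 5" for i j
    using that by (auto simp: wheel_adj_def)
  have "a < 5 \<or> b < 5" "a < 5 \<or> c < 5" "a < 5 \<or> d < 5" "b < 5 \<or> c < 5" "b < 5 \<or> d < 5"
    "c < 5 \<or> d < 5"
    by (rule one; fact)+
  thus False
    using rim_triangle_free[OF assms(1,4,2)] rim_triangle_free[OF assms(1,5,3)]
      rim_triangle_free[OF assms(2,6,3)] rim_triangle_free[OF assms(4,6,5)]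
    by blast
qed

text \<open>\<open>part m\<close> maps edges to edges of the wheel, so a 4-clique would give four
  pairwise adjacent wheel vertices.\<close>

lemma K4_free_wheel_blowup: "K4_free n (wheel_blowup n m)"
  unfolding K4_free_def
proof
  assume "\<exists>K. is_clique n (wheel_blowup n m) K \<and> card K = 4"
  then obtain K where K: "is_clique n (wheel_blowup n m) K" "card K = Suc (Suc (Suc (Suc 0)))"
    by (auto simp: numeral_eq_Suc)
  then obtain a b c d where "K = {a, b, c, d}" "distinct [a, b, c, d]"
    by (auto simp: card_Suc_eq)
  with K(1) show False
    using wheel_K4_free[OF _ _ _ _ _ _ part_le part_le part_le part_le, of m a m b m c m d]
    by (auto simp: is_clique_def wheel_blowup_def)
qed

section \<open>Class sizes and the action of the signless Laplacian\<close>

lemma card_part: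
  assumes "5 * m \<le> n" "j \<le> 5"
  shows "card {u. u < n \<and> part m u = j} = (if j = 5 then n - 5 * m else m)"
proof (cases "j = 5")
  case True
  have "part m u = 5 \<longleftrightarrow> 5 * m \<le> u" for u
    using less_mult_imp_div_less[of u 5 m] by (auto simp: part_def)
  hence "{u. u < n \<and> part m u = j} = {5 * m..<n}"
    by (simp add: True set_eq_iff conj_commute)
  thus ?thesis using True by simp
next
  case False
  have j: "j < 5" using False assms by simp
  show ?thesis
  proof (cases "m = 0")
    case True
    thus ?thesis using False by (auto simp: part_def)
  next
    case m: False
    have le: "(j + 1) * m \<le> 5 * m" using j by (intro mult_right_mono) auto
    have div: "u div m = j \<longleftrightarrow> j * m \<le> u \<and> u < (j + 1) * m" for u
      using m less_eq_div_iff_mult_less_eq[of m j u] div_less_iff_less_mult[of m u "j + 1"]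
      by auto
    have "u < n \<and> part m u = j \<longleftrightarrow> j * m \<le> u \<and> u < (j + 1) * m" for u
    proof (cases "u < 5 * m")
      case True
      hence "u < n" "part m u = u div m" using assms by (simp_all add: part_def)
      thus ?thesis by (simp only: div simp_thms)
    next
      case outside: False
      hence "part m u \<noteq> j" "\<not> u < (j + 1) * m"
        using False le by (simp add: part_def, linarith)
      thus ?thesis by simp
    qed
    hence "{u. u < n \<and> part m u = j} = {j * m..<(j + 1) * m}"
      by (simp only: set_eq_iff mem_Collect_eq atLeastLessThan_iff simp_thms)
    thus ?thesis using False by simp
  qed
qed

text \<open>Neighbourhoods are unions of classes, so only the class sums of \<open>f\<close> matter.
  Adding 4 modulo 5 gives the preceding rim class without subtraction on naturals.\<close>

lemma sum_neighbours:
  assumes "u < n"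
  shows "(\<Sum>w | w < n \<and> wheel_blowup n m u w. f w) =
    (if part m u = 5 then (\<Sum>j<5. part_sum n m f j)
     else part_sum n m f 5 + part_sum n m f ((part m u + 1) mod 5)
       + part_sum n m f ((part m u + 4) mod 5))"
proof -
  let ?g = "\<lambda>w. if wheel_adj (part m u) (part m w) then f w else 0"
  have "(\<Sum>w | w < n \<and> wheel_blowup n m u w. f w) = (\<Sum>w\<in>{..<n}. ?g w)"
    using assms by (intro sum.mono_neutral_cong_left) (auto simp: wheel_blowup_def)
  also have "\<dots> = (\<Sum>j\<in>{..<6}. sum ?g {w \<in> {..<n}. part m w = j})"
    by (rule sum.group[symmetric]) (use part_le in \<open>auto simp: less_Suc_eq_le numeral_eq_Suc\<close>)
  also have "\<dots> = (\<Sum>j<6. if wheel_adj (part m u) j then part_sum n m f j else 0)"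
    by (intro sum.cong refl) (auto simp: part_sum_def intro!: sum.cong)
  also have "\<dots> = (if part m u = 5 then (\<Sum>j<5. part_sum n m f j)
     else part_sum n m f 5 + part_sum n m f ((part m u + 1) mod 5)
       + part_sum n m f ((part m u + 4) mod 5))"
  proof -
    have six: "(\<Sum>j<6. g j) = g 0 + g 1 + g 2 + g 3 + g 4 + g 5"
      and five: "(\<Sum>j<5. g j) = g 0 + g 1 + g 2 + g 3 + g 4" for g :: "nat \<Rightarrow> real"
      by (simp_all add: eval_nat_numeral)
    consider "part m u = 5" | "part m u < 5"
      using part_le[of m u] by linarith
    thus ?thesis
      unfolding six five
      by cases (simp add: wheel_adj_def, elim less_5_cases, simp_all add: wheel_adj_def numeral_2_eq_2)
  qed
  finally show ?thesis .
qed

text \<open>The degree is written as a neighbour sum of ones, so that \<open>sum_neighbours\<close>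
  evaluates both terms.\<close>

lemma signless_laplacian_mult_vec:
  assumes "v \<in> carrier_vec n" "u < n"
  shows "(signless_laplacian n E *\<^sub>v v) $ u =
    (\<Sum>w | w < n \<and> E u w. 1) * v $ u + (\<Sum>w | w < n \<and> E u w. v $ w)"
proof -
  have "(signless_laplacian n E *\<^sub>v v) $ u =
      (\<Sum>w<n. (if u = w then real (degree_of n E u) * v $ w else 0) + (if E u w then v $ w else 0))"
    using assms by (auto simp: signless_laplacian_def degree_matrix_def adjacency_matrix_def
        scalar_prod_def atLeast0LessThan algebra_simps intro!: sum.cong)
  also have "\<dots> = real (degree_of n E u) * v $ u + (\<Sum>w<n. if E u w then v $ w else 0)"
    using assms by (simp add: sum.distrib)
  also have "(\<Sum>w<n. if E u w then v $ w else 0) = (\<Sum>w | w < n \<and> E u w. v $ w)"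
    by (intro sum.mono_neutral_cong_right) auto
  finally show ?thesis by (simp add: degree_of_def)
qed

lemma wheel_blowup_mult_vec:
  assumes "5 * m \<le> n" "v \<in> carrier_vec n" "u < n"
  shows "(signless_laplacian n (wheel_blowup n m) *\<^sub>v v) $ u =
    (if part m u = 5 then 5 * real m * v $ u + (\<Sum>j<5. part_sum n m (($) v) j)
     else (real (n - 5 * m) + 2 * real m) * v $ u + part_sum n m (($) v) 5
       + part_sum n m (($) v) ((part m u + 1) mod 5)
       + part_sum n m (($) v) ((part m u + 4) mod 5))"
proof -
  \<comment> \<open>Class sums of the constant 1 are class sizes; they yield degree 5m in the hub
    and (n - 5m) + 2m on the rim.\<close>
  have one: "part_sum n m (\<lambda>_. 1) j = (if j = 5 then real (n - 5 * m) else real m)" if "j \<le> 5" for j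
    using card_part[OF assms(1) that] by (simp add: part_sum_def)
  have "(\<Sum>j<5. part_sum n m (\<lambda>_. 1) j) = (\<Sum>j<(5::nat). real m)"
    by (intro sum.cong) (auto simp: one)
  moreover have "i mod 5 \<le> 5" "i mod 5 \<noteq> 5" for i :: nat
    using mod_less_divisor[of 5 i] by linarith+
  ultimately show ?thesis
    unfolding signless_laplacian_mult_vec[OF assms(2,3)] sum_neighbours[OF assms(3)]
    by (simp add: one)
qed

section \<open>Eigenvalues of the blow-up\<close>

text \<open>Here \<open>a\<close> sits at a pentagon vertex with neighbours \<open>b\<close> and
  \<open>f\<close>, whose other neighbours are \<open>c\<close> and \<open>e\<close>. The nontrivial
  adjacency eigenvalues of the pentagon are the roots x of x^2 + x - 1; the first hypothesis
  excludes d = - x M.\<close>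

lemma pentagon_kernel:
  fixes a b c e f d M :: real
  assumes "d\<^sup>2 - d * M - M\<^sup>2 \<noteq> 0" "d * a + M * (b + f) = 0"
    "d * b + M * (c + a) = 0" "d * f + M * (a + e) = 0" "a + b + c + e + f = 0"
  shows "a = 0"
proof -
  \<comment> \<open>The pentagon's adjacency matrix A satisfies A^2 + A - I = J (all ones), hence (d
    - M - M A)(d + M A) = (d^2 - d M - M^2) I - M^2 J. This is its row at \<open>a\<close>.\<close>
  have "(d\<^sup>2 - d * M - M\<^sup>2) * a = (d - M) * (d * a + M * (b + f)) - M * (d * b + M * (c + a))
      - M * (d * f + M * (a + e)) + M * M * (a + b + c + e + f)"
    by (simp add: power2_eq_square algebra_simps)
  thus ?thesis using assms by simp
qed

text \<open>If all four alternatives fail, the quadratic kills the rim total, \<open>5 * M\<close>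
  the hub sum, and the pentagon condition each rim sum. Every vertex equation then reduces to a
  nonzero multiple of the entry, so the eigenvector vanishes.\<close>

lemma eigenvalue_wheel_blowup_cases:
  assumes mn: "5 * m \<le> n" and ev: "eigenvalue (signless_laplacian n (wheel_blowup n m)) q"
  defines "h \<equiv> real (n - 5 * m)" and "M \<equiv> real m"
  shows "q = 5 * M \<or> q = h + 2 * M \<or> (q - 5 * M) * (q - h - 4 * M) = 5 * M * h
    \<or> (h + 2 * M - q)\<^sup>2 = (h + 2 * M - q) * M + M\<^sup>2"
proof (rule ccontr)
  assume neg: "\<not> ?thesis"
  let ?Q = "signless_laplacian n (wheel_blowup n m)"
  obtain v where v: "v \<in> carrier_vec n" "v \<noteq> 0\<^sub>v n" "?Q *\<^sub>v v = q \<cdot>\<^sub>v v"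
    using ev signless_laplacian_carrier[of n "wheel_blowup n m"]
    unfolding eigenvalue_def eigenvector_def by auto
  define S where "S = part_sum n m (($) v)"
  define d where "d = h + 2 * M - q"
  have hub: "q * v $ u = 5 * M * v $ u + (\<Sum>j<5. S j)" if "u < n" "part m u = 5" for u
    using wheel_blowup_mult_vec[OF mn v(1) that(1)] v that by (simp add: S_def M_def)
  have rim: "q * v $ u = (h + 2 * M) * v $ u + (S 5 + S ((i + 1) mod 5) + S ((i + 4) mod 5))"
    if "u < n" "part m u = i" "i < 5" for u i
    using wheel_blowup_mult_vec[OF mn v(1) that(1)] v that by (simp add: S_def M_def h_def)
  have avg: "q * S j = a * S j + real (card {u. u < n \<and> part m u = j}) * c"
    if "\<And>u. u < n \<Longrightarrow> part m u = j \<Longrightarrow> q * v $ u = a * v $ u + c" for j a c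
  proof -
    have "q * S j = (\<Sum>u | u < n \<and> part m u = j. q * v $ u)"
      by (simp add: S_def part_sum_def sum_distrib_left)
    also have "\<dots> = (\<Sum>u | u < n \<and> part m u = j. a * v $ u + c)"
      using that by (intro sum.cong) auto
    also have "\<dots> = a * S j + real (card {u. u < n \<and> part m u = j}) * c"
      by (simp add: S_def part_sum_def sum_distrib_left sum.distrib)
    finally show ?thesis .
  qed
  define T where "T = (\<Sum>j<5. S j)"
  have T: "T = S 0 + S 1 + S 2 + S 3 + S 4"
    by (simp add: T_def eval_nat_numeral)
  have S5: "(q - 5 * M) * S 5 = h * T"
    using avg[of 5, OF hub] card_part[OF mn, of 5] by (simp add: h_def T_def algebra_simps)
  have "d * S i + M * (S 5 + S ((i + 1) mod 5) + S ((i + 4) mod 5)) = 0" if "i < 5" for i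
    using avg[of i, OF rim] card_part[OF mn, of i] that by (simp add: M_def d_def algebra_simps)
  from this[of 0] this[of 1] this[of 2] this[of 3] this[of 4]
  have R: "d * S 0 + M * (S 5 + S 1 + S 4) = 0" "d * S 1 + M * (S 5 + S 2 + S 0) = 0"
    "d * S 2 + M * (S 5 + S 3 + S 1) = 0" "d * S 3 + M * (S 5 + S 4 + S 2) = 0"
    "d * S 4 + M * (S 5 + S 0 + S 3) = 0"
    by (simp_all add: numeral_2_eq_2)
  \<comment> \<open>Adding the five rim equations counts each rim sum twice as a neighbour and the
    hub sum five times.\<close>
  have T': "(q - h - 4 * M) * T = 5 * M * S 5"
    using R unfolding T d_def by (simp add: algebra_simps)
  \<comment> \<open>The factor is the determinant of the 2 x 2 system for the rim total and the hub
    sum.\<close>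
  have "((q - 5 * M) * (q - h - 4 * M) - 5 * M * h) * T = 0"
  proof -
    have "((q - 5 * M) * (q - h - 4 * M) - 5 * M * h) * T
        = (q - 5 * M) * ((q - h - 4 * M) * T) - 5 * M * (h * T)"
      by (simp add: algebra_simps)
    also have "\<dots> = 0"
      unfolding T' S5[symmetric] by (simp add: algebra_simps)
    finally show ?thesis .
  qed
  hence T0: "T = 0" using neg by simp
  hence S50: "S 5 = 0" using S5 neg by simp
  have "d\<^sup>2 - d * M - M\<^sup>2 \<noteq> 0"
    using neg by (simp add: d_def)
  note pentagon = pentagon_kernel[OF this]
  \<comment> \<open>Five rotations of one argument. The instantiation order is
    \<open>a b f c e\<close>: a class, its two neighbours, then the two remaining classes.\<close>
  have S0: "S i = 0" if "i < 5" for i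
    using that
  proof (cases rule: less_5_cases)
    case 1
    thus ?thesis using pentagon[of "S 0" "S 1" "S 4" "S 2" "S 3"] R S50 T0 T by (simp add: add_ac)
  next
    case 2
    thus ?thesis using pentagon[of "S 1" "S 2" "S 0" "S 3" "S 4"] R S50 T0 T by (simp add: add_ac)
  next
    case 3
    thus ?thesis using pentagon[of "S 2" "S 3" "S 1" "S 4" "S 0"] R S50 T0 T by (simp add: add_ac)
  next
    case 4
    thus ?thesis using pentagon[of "S 3" "S 4" "S 2" "S 0" "S 1"] R S50 T0 T by (simp add: add_ac)
  next
    case 5
    thus ?thesis using pentagon[of "S 4" "S 0" "S 3" "S 1" "S 2"] R S50 T0 T by (simp add: add_ac)
  qed
  have "v $ u = 0" if u: "u < n" for u
  proof (cases "part m u = 5")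
    case True
    thus ?thesis using hub[OF u] T0 neg by (simp add: T_def)
  next
    case False
    hence "part m u < 5" using part_le[of m u] by simp
    thus ?thesis using rim[OF u refl] S0 S50 neg by simp
  qed
  hence "v = 0\<^sub>v n" using v(1) by (intro eq_vecI) auto
  thus False using v(2) by simp
qed

text \<open>The eigenvector is a pentagon eigenvector for the least adjacency eigenvalue -\<phi>,
  spread over the rim classes and zero on the hub. Its rim total vanishes, which settles the hub
  equations.\<close>

lemma eigenvalue_wheel_blowup:
  assumes mn: "5 * m \<le> n" and m: "m > 0"
  defines "\<phi> \<equiv> (1 + sqrt 5) / 2"
  shows "eigenvalue (signless_laplacian n (wheel_blowup n m)) (real (n - 5 * m) + (2 - \<phi>) * real m)"
    (is "eigenvalue ?Q ?q")
proof -
  have "\<phi> * \<phi> = \<phi> + 1"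
    by (simp add: \<phi>_def field_simps)
  \<comment> \<open>The relation is stated for nested products so that it still rewrites after
    \<open>algebra_simps\<close> has reassociated.\<close>
  hence phi: "\<phi> * (\<phi> * x) = \<phi> * x + x" for x
    by (metis distrib_right mult.assoc mult_1)
  \<comment> \<open>\<open>c\<^sub>j = 2 cos (4 \<pi> j / 5)\<close> on the pentagon\<close>
  define c where "c = (!) [2, - \<phi>, \<phi> - 1, \<phi> - 1, - \<phi>, 0]"
  define v where "v = vec n (\<lambda>u. c (part m u))"
  have v: "v \<in> carrier_vec n" by (simp add: v_def)
  have S: "part_sum n m (($) v) j = (if j = 5 then 0 else real m * c j)" if "j \<le> 5" for j
  proof -
    have "part_sum n m (($) v) j = (\<Sum>u | u < n \<and> part m u = j. c j)"
      unfolding part_sum_def by (intro sum.cong) (auto simp: v_def)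
    thus ?thesis using card_part[OF mn that] by (simp add: c_def)
  qed
  have "?Q *\<^sub>v v = ?q \<cdot>\<^sub>v v"
  proof (intro eq_vecI)
    fix u assume "u < dim_vec (?q \<cdot>\<^sub>v v)"
    hence u: "u < n" using v by simp
    have vu: "v $ u = c (part m u)" using u by (simp add: v_def)
    show "(?Q *\<^sub>v v) $ u = (?q \<cdot>\<^sub>v v) $ u"
    proof (cases "part m u = 5")
      case True
      have "(\<Sum>j<5. part_sum n m (($) v) j) = (\<Sum>j<5. real m * c j)"
        by (intro sum.cong) (auto simp: S)
      also have "\<dots> = 0" by (simp add: c_def eval_nat_numeral algebra_simps)
      finally show ?thesis
        using True wheel_blowup_mult_vec[OF mn v u] u v by (simp add: vu) (simp add: c_def)
    next
      case False
      hence "part m u < 5" using part_le[of m u] by simp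
      thus ?thesis
        using wheel_blowup_mult_vec[OF mn v u] u v
        by (elim less_5_cases) (simp_all add: vu S, simp_all add: c_def phi algebra_simps)
    qed
  qed (use v signless_laplacian_carrier[of n "wheel_blowup n m"] in auto)
  moreover have "v \<noteq> 0\<^sub>v n"
  proof
    assume "v = 0\<^sub>v n"
    hence "v $ 0 = 0" using mn m by simp
    moreover have "v $ 0 = 2" using mn m by (simp add: v_def part_def c_def)
    ultimately show False by simp
  qed
  ultimately show ?thesis
    using v signless_laplacian_carrier[of n "wheel_blowup n m"]
    unfolding eigenvalue_def eigenvector_def by auto
qed

section \<open>Bounds for the least eigenvalue\<close>

lemma signless_eigenvalue_least_props:
  assumes "simple_graph n E" "n \<ge> 1"
  shows "eigenvalue (signless_laplacian n E) (signless_eigenvalue n E n)"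
    and "eigenvalue (signless_laplacian n E) q \<Longrightarrow> signless_eigenvalue n E n \<le> q"
proof -
  let ?A = "{q. eigenvalue (signless_laplacian n E) q}"
  have fin: "finite ?A" by (metis set_signless_eigenvalues List.finite_set)
  have "?A \<noteq> {}"
    using length_signless_eigenvalues[OF assms(1)] assms(2)
    by (metis set_signless_eigenvalues set_empty list.size(3) not_one_le_zero)
  from Min_in[OF fin this] show "eigenvalue (signless_laplacian n E) (signless_eigenvalue n E n)"
    using signless_eigenvalue_least[OF assms] by simp
  show "signless_eigenvalue n E n \<le> q" if "eigenvalue (signless_laplacian n E) q"
    using signless_eigenvalue_least[OF assms] Min_le[OF fin] that by simp
qed

text \<open>The discriminant is the square of \<open>s - 2 * x\<close>, and its square root
  \<open>\<bar>s - 2 * x\<bar>\<close> is at least \<open>s - 2 * x\<close>.\<close>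

lemma root_ge_of_quadratic:
  fixes x s p :: real
  assumes "x\<^sup>2 - s * x + p = 0"
  shows "(s - sqrt (s\<^sup>2 - 4 * p)) / 2 \<le> x"
proof -
  have "s\<^sup>2 - 4 * p = (s - 2 * x)\<^sup>2"
    using assms by (simp add: power2_eq_square algebra_simps)
  thus ?thesis by simp
qed

text \<open>The upper bound is the eigenvalue exhibited above; the lower bound is the least of all
  candidates. For suitable densities the two agree asymptotically.\<close>

lemma least_eigenvalue_wheel_blowup_bounds:
  assumes mn: "5 * m \<le> n" and m: "m > 0"
  defines "h \<equiv> real (n - 5 * m)" and "M \<equiv> real m" and "\<phi> \<equiv> (1 + sqrt 5) / 2"
  shows "signless_eigenvalue n (wheel_blowup n m) n \<le> h + (2 - \<phi>) * M"
    and "min (5 * M) (min (h + (2 - \<phi>) * M) ((h + 9 * M - sqrt ((h + 9 * M)\<^sup>2 - 80 * M\<^sup>2)) / 2))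
      \<le> signless_eigenvalue n (wheel_blowup n m) n" (is "?min \<le> ?q")
proof -
  note least = signless_eigenvalue_least_props[OF simple_graph_wheel_blowup, of n m]
  have n: "n \<ge> 1" using mn m by simp
  show "?q \<le> h + (2 - \<phi>) * M"
    unfolding h_def M_def \<phi>_def by (rule least(2)[OF n eigenvalue_wheel_blowup[OF mn m]])
  have M: "M > 0" using m by (simp add: M_def)
  have phi: "\<phi> > 0" "\<phi> * \<phi> = \<phi> + 1"
    by (simp_all add: \<phi>_def field_simps add_pos_pos)
  consider "?q = 5 * M" | "?q = h + 2 * M" | "(?q - 5 * M) * (?q - h - 4 * M) = 5 * M * h"
    | "(h + 2 * M - ?q)\<^sup>2 = (h + 2 * M - ?q) * M + M\<^sup>2"
    using eigenvalue_wheel_blowup_cases[OF mn least(1)[OF n]] unfolding h_def M_def by blast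
  thus "?min \<le> ?q"
  proof cases
    case 2
    have "0 < \<phi> * M" using M phi by simp
    thus ?thesis using 2 by (simp add: algebra_simps)
  next
    case 3
    \<comment> \<open>The terms \<open>5 * M * h\<close> cancel, leaving product of roots
      \<open>20 * M\<^sup>2\<close>, whence the 80 in the discriminant.\<close>
    hence "?q\<^sup>2 - (h + 9 * M) * ?q + 20 * M\<^sup>2 = 0"
      by (simp add: power2_eq_square algebra_simps)
    from root_ge_of_quadratic[OF this] show ?thesis by (auto simp: min_le_iff_disj)
  next
    case 4
    define d where "d = h + 2 * M - ?q"
    \<comment> \<open>Of the two roots \<phi>M and (1 - \<phi>)M the first is the larger, so
      \<open>d\<close> is at most \<phi>M.\<close>
    have "(d - \<phi> * M) * (d + (\<phi> - 1) * M) = (d\<^sup>2 - d * M - M\<^sup>2) - (\<phi> * \<phi> - \<phi> - 1) * M\<^sup>2"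
      by (simp add: power2_eq_square algebra_simps)
    hence "(d - \<phi> * M) * (d + (\<phi> - 1) * M) = 0"
      using 4 phi(2) by (simp add: d_def)
    moreover have "d + (\<phi> - 1) * M > 0" if "d > \<phi> * M"
    proof -
      have "0 \<le> (\<phi> - 1) * M" "0 < \<phi> * M" using M phi by (simp_all add: \<phi>_def)
      thus ?thesis using that by linarith
    qed
    ultimately have "d \<le> \<phi> * M" by (metis less_irrefl mult_eq_0_iff not_le right_minus_eq)
    thus ?thesis by (simp add: d_def algebra_simps)
  qed simp
qed

section \<open>Passing to the limit at fixed density\<close>

lemma tendsto_floor_density:
  fixes \<beta> :: real
  assumes "\<beta> \<ge> 0"
  shows "(\<lambda>n. real (nat \<lfloor>\<beta> * real n\<rfloor>) / real n) \<longlonglongrightarrow> \<beta>"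
proof (rule tendsto_sandwich)
  show "(\<lambda>n. \<beta> - 1 / real n) \<longlonglongrightarrow> \<beta>"
    using tendsto_diff[OF tendsto_const lim_1_over_n] by simp
  show "\<forall>\<^sub>F n in sequentially. \<beta> - 1 / real n \<le> real (nat \<lfloor>\<beta> * real n\<rfloor>) / real n"
    using eventually_gt_at_top[of 0]
  proof eventually_elim
    case (elim n)
    have "\<beta> * real n - 1 \<le> real (nat \<lfloor>\<beta> * real n\<rfloor>)" by linarith
    hence "(\<beta> * real n - 1) / real n \<le> real (nat \<lfloor>\<beta> * real n\<rfloor>) / real n"
      by (intro divide_right_mono) auto
    thus ?case using elim by (simp add: diff_divide_distrib)
  qed
  show "\<forall>\<^sub>F n in sequentially. real (nat \<lfloor>\<beta> * real n\<rfloor>) / real n \<le> \<beta>"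
    using eventually_gt_at_top[of 0]
  proof eventually_elim
    case (elim n)
    have "real (nat \<lfloor>\<beta> * real n\<rfloor>) \<le> \<beta> * real n" using assms by simp
    thus ?case using elim by (simp add: field_simps)
  qed
qed auto

text \<open>Both bounds are homogeneous of degree 1 in the class sizes, so after division by
  \<open>n\<close> they are continuous functions of the class densities. The conditions on \<rho>
  make it the least candidate in the limit, so the two bounds meet.\<close>

lemma tendsto_least_eigenvalue_wheel_blowup:
  fixes \<beta> :: real
  assumes beta: "0 < \<beta>" "5 * \<beta> \<le> 1"
  defines "m \<equiv> \<lambda>n. nat \<lfloor>\<beta> * real n\<rfloor>" and "\<rho> \<equiv> 1 - 5 * \<beta> + (2 - (1 + sqrt 5) / 2) * \<beta>"
  assumes rho: "\<rho> \<le> 5 * \<beta>" "\<rho> \<le> (1 + 4 * \<beta> - sqrt ((1 + 4 * \<beta>)\<^sup>2 - 80 * \<beta>\<^sup>2)) / 2"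
  shows "(\<lambda>n. signless_eigenvalue n (wheel_blowup n (m n)) n / real n) \<longlonglongrightarrow> \<rho>"
proof -
  define x where "x n = real (m n) / real n" for n
  define y where "y n = real (n - 5 * m n) / real n" for n
  define \<phi> where "\<phi> = (1 + sqrt 5) / 2"
  define r where "r h M = (h + 9 * M - sqrt ((h + 9 * M)\<^sup>2 - 80 * M\<^sup>2)) / 2" for h M :: real
  have x: "x \<longlonglongrightarrow> \<beta>"
    unfolding x_def m_def using tendsto_floor_density beta(1) by simp
  have mn: "5 * m n \<le> n" for n
  proof -
    have "real (m n) \<le> \<beta> * real n" using beta(1) by (simp add: m_def)
    hence "real (5 * m n) \<le> (5 * \<beta>) * real n" by simp
    also have "\<dots> \<le> real n" using mult_right_mono[OF beta(2), of "real n"] by simp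
    finally show ?thesis by linarith
  qed
  have "\<forall>\<^sub>F n in sequentially. 1 - 5 * x n = y n"
    using eventually_gt_at_top[of 0]
    by eventually_elim (use mn in \<open>simp add: x_def y_def of_nat_diff field_simps\<close>)
  moreover have "(\<lambda>n. 1 - 5 * x n) \<longlonglongrightarrow> 1 - 5 * \<beta>"
    by (intro tendsto_intros x)
  ultimately have y: "y \<longlonglongrightarrow> 1 - 5 * \<beta>"
    using Lim_transform_eventually by blast
  have pos: "\<forall>\<^sub>F n in sequentially. 0 < m n \<and> 0 < n"
    using order_tendstoD(1)[OF x beta(1)]
    by eventually_elim (auto simp: x_def zero_less_divide_iff)
  have scale: "r h M / N = r (h / N) (M / N)" if "N > 0" for h M N
  proof -
    have "(h / N + 9 * (M / N))\<^sup>2 - 80 * (M / N)\<^sup>2 = ((h + 9 * M)\<^sup>2 - 80 * M\<^sup>2) / N\<^sup>2"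
      using that by (simp add: field_simps power2_eq_square)
    hence "sqrt ((h / N + 9 * (M / N))\<^sup>2 - 80 * (M / N)\<^sup>2) = sqrt ((h + 9 * M)\<^sup>2 - 80 * M\<^sup>2) / N"
      using that by (simp add: real_sqrt_divide)
    thus ?thesis using that by (simp add: r_def field_simps)
  qed
  show ?thesis
  proof (rule tendsto_sandwich)
    show "\<forall>\<^sub>F n in sequentially. min (5 * x n) (min (y n + (2 - \<phi>) * x n) (r (y n) (x n)))
        \<le> signless_eigenvalue n (wheel_blowup n (m n)) n / real n"
      using pos
    proof eventually_elim
      case (elim n)
      have "min (5 * real (m n)) (min (real (n - 5 * m n) + (2 - \<phi>) * real (m n))
          (r (real (n - 5 * m n)) (real (m n)))) / real n
        \<le> signless_eigenvalue n (wheel_blowup n (m n)) n / real n"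
        using least_eigenvalue_wheel_blowup_bounds(2)[OF mn, of n] elim
        unfolding r_def \<phi>_def by (intro divide_right_mono) auto
      thus ?case
        using elim by (simp add: min_divide_distrib_right scale x_def y_def add_divide_distrib)
    qed
    show "\<forall>\<^sub>F n in sequentially. signless_eigenvalue n (wheel_blowup n (m n)) n / real n
        \<le> y n + (2 - \<phi>) * x n"
      using pos
    proof eventually_elim
      case (elim n)
      have "signless_eigenvalue n (wheel_blowup n (m n)) n / real n
        \<le> (real (n - 5 * m n) + (2 - \<phi>) * real (m n)) / real n"
        using least_eigenvalue_wheel_blowup_bounds(1)[OF mn, of n] elim
        unfolding \<phi>_def by (intro divide_right_mono) auto
      thus ?case by (simp add: x_def y_def add_divide_distrib)
    qed
    have rho_eq: "\<rho> = 1 - 5 * \<beta> + (2 - \<phi>) * \<beta>" by (simp add: \<rho>_def \<phi>_def)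
    show "(\<lambda>n. y n + (2 - \<phi>) * x n) \<longlonglongrightarrow> \<rho>"
      unfolding rho_eq by (intro tendsto_intros x y)
    have "(\<lambda>n. min (5 * x n) (min (y n + (2 - \<phi>) * x n) (r (y n) (x n))))
        \<longlonglongrightarrow> min (5 * \<beta>) (min \<rho> (r (1 - 5 * \<beta>) \<beta>))"
      unfolding rho_eq r_def by (intro tendsto_intros x y) auto
    also have "min (5 * \<beta>) (min \<rho> (r (1 - 5 * \<beta>) \<beta>)) = \<rho>"
      using rho by (simp add: r_def min_def add_ac)
    finally show "(\<lambda>n. min (5 * x n) (min (y n + (2 - \<phi>) * x n) (r (y n) (x n)))) \<longlonglongrightarrow> \<rho>" .
  qed
qed

section \<open>Numerical values and the optimal density\<close>

lemma sqrt_5_bounds: "2.23606797749 < sqrt 5" "sqrt 5 < 2.23606797750"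
  by (rule real_less_rsqrt, simp add: power2_eq_square)
    (rule real_less_lsqrt, simp_all add: power2_eq_square)

text \<open>Rationalising, with 137^2 - 5 * 7^2 = 44 * 421, makes the limit linear in
  \<open>sqrt 5\<close>, so bounds on \<open>sqrt 5\<close> transfer directly.\<close>

lemma limit_value_eq: "(60 - 4 * sqrt 5) / (137 + 7 * sqrt 5) = (190 - 22 * sqrt 5) / 421"
proof -
  have "137 + 7 * sqrt 5 > 0" by (simp add: add_pos_pos)
  thus ?thesis by (simp add: field_simps)
qed

theorem theorem1p14:
  shows "(\<exists>G :: nat \<Rightarrow> nat \<Rightarrow> nat \<Rightarrow> bool.
            (\<forall>n\<ge>1. simple_graph n (G n) \<and> K4_free n (G n)) \<and>
            (\<lambda>n. signless_eigenvalue n (G n) n / real n)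
              \<longlonglongrightarrow> (60 - 4 * sqrt 5) / (137 + 7 * sqrt 5)) \<and>
         (0.3344572553 :: real) \<le> (60 - 4 * sqrt 5) / (137 + 7 * sqrt 5) \<and>
         (60 - 4 * sqrt 5) / (137 + 7 * sqrt 5) < (0.3344572554 :: real) \<and>
         (60 - 4 * sqrt 5) / (137 + 7 * sqrt 5) > (1 / 3 :: real)"
proof (intro conjI exI allI impI)
  \<comment> \<open>With hub density h = 1 - 5\<beta> and M = \<beta>, requiring h + (2 - \<phi>)M
    to solve the quadratic gives (7 + \<phi>)h = (7 + 6\<phi>)M, hence \<beta> = (7 + \<phi>)/(42 +
    11\<phi>).\<close>
  define \<beta> :: real where "\<beta> = (137 - 7 * sqrt 5) / 842"
  define \<rho> :: real where "\<rho> = (190 - 22 * sqrt 5) / 421"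
  have rho: "\<rho> = 1 - 5 * \<beta> + (2 - (1 + sqrt 5) / 2) * \<beta>"
    by (simp add: \<rho>_def \<beta>_def field_simps)
  \<comment> \<open>This says that \<rho> is a root of the limiting quadratic; the sign condition
    that follows identifies it as the smaller one.\<close>
  have "(1 + 4 * \<beta>)\<^sup>2 - 80 * \<beta>\<^sup>2 = (1 + 4 * \<beta> - 2 * \<rho>)\<^sup>2"
    by (simp add: \<rho>_def \<beta>_def power2_eq_square field_simps)
  moreover have "1 + 4 * \<beta> - 2 * \<rho> \<ge> 0"
    using sqrt_5_bounds by (simp add: \<rho>_def \<beta>_def field_simps)
  ultimately have "\<rho> \<le> (1 + 4 * \<beta> - sqrt ((1 + 4 * \<beta>)\<^sup>2 - 80 * \<beta>\<^sup>2)) / 2"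
    by simp
  moreover have "0 < \<beta>" "5 * \<beta> \<le> 1" "\<rho> \<le> 5 * \<beta>"
    using sqrt_5_bounds by (simp_all add: \<rho>_def \<beta>_def)
  ultimately show "(\<lambda>n. signless_eigenvalue n (wheel_blowup n (nat \<lfloor>\<beta> * real n\<rfloor>)) n / real n)
      \<longlonglongrightarrow> (60 - 4 * sqrt 5) / (137 + 7 * sqrt 5)"
    using tendsto_least_eigenvalue_wheel_blowup[of \<beta>]
    unfolding limit_value_eq rho[symmetric] \<rho>_def[symmetric] by simp
  show "simple_graph n (wheel_blowup n (nat \<lfloor>\<beta> * real n\<rfloor>))"
    "K4_free n (wheel_blowup n (nat \<lfloor>\<beta> * real n\<rfloor>))" for n
    by (rule simple_graph_wheel_blowup K4_free_wheel_blowup)+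
qed (use sqrt_5_bounds in \<open>simp_all add: limit_value_eq\<close>)

end
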